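(* Let $A\in Gl(d,\mathbb{R})$, $B\in\mathbb{R}^{d\times m}$, and let $U\subset\mathbb{R}^m$ be a convex compact neighborhood of $0$ with $U=\overline{\mathrm{int}\,U}$. Assume that $(A,B)$ is controllable, i.e. $\mathrm{rank}[B\ AB\ \cdots\ A^{d-1}B]=d$. Then the control set $D$ with nonvoid interior of the system $x_{k+1}=Ax_k+Bu_k$, $u_k\in U$, $k\in\mathbb{N}_0$, is bounded if and only if $A$ is hyperbolic, i.e. all eigenvalues $\lambda$ of $A$ satisfy $|\lambda|\neq1$.
   Context: $\mathbb{N}=\{1,2,\dots\}$, $\mathbb{N}_0=\{0,1,2,\dots\}$, $\mathcal{U}=U^{\mathbb{N}_0}$. For $x\in\mathbb{R}^d$, $u=(u_i)\in\mathcal{U}$ the solution is $\varphi(k,x,u)=A^kx+\sum_{i=0}^{k-1}A^{k-1-i}Bu_i$. The reachable set is $\mathbf{R}(x)=\{\varphi(k,x,u)\mid k\in\mathbb{N},u\in\mathcal{U}\}$. A nonvoid set $D\subset\mathbb{R}^d$ is a control set if it is maximal (with respect to inclusion) with the properties: (i) $D\subset\overline{\mathbf{R}(x)}$ for all $x\in D$; (ii) for every $x\in D$ there is $u\in\mathcal{U}$ with $\varphi(k,x,u)\in D$ for all $k\in\mathbb{N}$. When $(A,B)$ is controllable there is exactly one control set with nonvoid interior. *)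

theory Defs
  imports "HOL-Analysis.Analysis"
begin

text \<open>The type of square matrices carries the componentwise product and hence a componentwise
  \<open>^\<close>; the matrix power has to be defined separately.\<close>

definition matrix_power :: "'a::semiring_1^'n^'n \<Rightarrow> nat \<Rightarrow> 'a^'n^'n" where
  "matrix_power A k = (((**) A) ^^ k) (mat 1)"

definition trajectory ::
  "real^'d^'d \<Rightarrow> real^'m^'d \<Rightarrow> nat \<Rightarrow> real^'d \<Rightarrow> (nat \<Rightarrow> real^'m) \<Rightarrow> real^'d" where
  "trajectory A B k x u =
     matrix_power A k *v x + (\<Sum>i<k. matrix_power A (k - 1 - i) *v (B *v u i))"

definition admissible_controls :: "(real^'m) set \<Rightarrow> (nat \<Rightarrow> real^'m) set" where
  "admissible_controls U = {u. \<forall>i. u i \<in> U}"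

definition reachable_set ::
  "real^'d^'d \<Rightarrow> real^'m^'d \<Rightarrow> (real^'m) set \<Rightarrow> real^'d \<Rightarrow> (real^'d) set" where
  "reachable_set A B U x =
     {trajectory A B k x u | k u. 1 \<le> k \<and> u \<in> admissible_controls U}"

definition pre_control_set ::
  "real^'d^'d \<Rightarrow> real^'m^'d \<Rightarrow> (real^'m) set \<Rightarrow> (real^'d) set \<Rightarrow> bool" where
  "pre_control_set A B U D \<longleftrightarrow>
     (\<forall>x\<in>D. D \<subseteq> closure (reachable_set A B U x)) \<and>
     (\<forall>x\<in>D. \<exists>u\<in>admissible_controls U. \<forall>k\<ge>1. trajectory A B k x u \<in> D)"

definition control_set ::
  "real^'d^'d \<Rightarrow> real^'m^'d \<Rightarrow> (real^'m) set \<Rightarrow> (real^'d) set \<Rightarrow> bool" where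
  "control_set A B U D \<longleftrightarrow>
     D \<noteq> {} \<and> pre_control_set A B U D \<and>
     (\<forall>D'. pre_control_set A B U D' \<and> D \<subseteq> D' \<longrightarrow> D' = D)"

text \<open>The block matrix \<open>[B AB \<dots> A\<^sup>d\<^sup>-\<^sup>1B]\<close>. Its columns are indexed by \<open>'d \<times> 'm\<close>: on the finite
  type \<open>'d\<close>, \<^term>\<open>to_nat_on UNIV\<close> is a bijection onto \<open>{..<CARD('d)}\<close>, so it enumerates
  the exponents \<open>0, \<dots>, d - 1\<close>. The choice of the bijection only permutes the blocks.\<close>

definition kalman_matrix :: "real^'d^'d \<Rightarrow> real^'m^'d \<Rightarrow> real^('d \<times> 'm)^'d" where
  "kalman_matrix A B =
     (\<chi> i p. (matrix_power A (to_nat_on (UNIV :: 'd set) (fst p)) ** B) $ i $ snd p)"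

definition controllable :: "real^'d^'d \<Rightarrow> real^'m^'d \<Rightarrow> bool" where
  "controllable A B \<longleftrightarrow> rank (kalman_matrix A B) = CARD('d)"

text \<open>Eigenvalues of a real matrix are its complex eigenvalues.\<close>

definition eigenvalue :: "real^'d^'d \<Rightarrow> complex \<Rightarrow> bool" where
  "eigenvalue A \<mu> \<longleftrightarrow> (\<exists>v :: complex^'d. v \<noteq> 0 \<and> map_matrix complex_of_real A *v v = \<mu> *s v)"

definition hyperbolic :: "real^'d^'d \<Rightarrow> bool" where
  "hyperbolic A \<longleftrightarrow> (\<forall>\<mu>. eigenvalue A \<mu> \<longrightarrow> cmod \<mu> \<noteq> 1)"

end

theory Submission
  imports Defs "HOL-Computational_Algebra.Fundamental_Theorem_Algebra"
begin

text \<open>If \<open>A\<close> is hyperbolic, a trajectory whose two end points lie in a fixed ball stays in a larger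
  fixed ball: its stable part is controlled from the start, its unstable part from the end. Every
  point of the control set is nearly the middle of such a trajectory from and to a neighbourhood of
  a fixed point.

  If \<open>A\<close> has an eigenvalue of modulus \<open>1\<close>, bounded controls reach arbitrarily far points \<open>p\<close> of the
  real eigenspace from \<open>0\<close> and can return to \<open>0\<close>. By maximality the control set contains every
  trajectory that joins two of its points. So a nearly closed trajectory in the interior, mixed with
  the loops through \<open>p\<close> and \<open>-p\<close> by convexity of \<open>U\<close>, yields points of the control set that are
  arbitrarily far apart.\<close>

section \<open>Trajectories and control sets\<close>

lemma trajectory_0 [simp]: "trajectory A B 0 x u = x"
  by (simp add: trajectory_def matrix_power_def)

lemma matrix_power_Suc: "matrix_power A (Suc k) = A ** matrix_power A k"
  by (simp add: matrix_power_def)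

lemma trajectory_Suc:
  "trajectory A B (Suc k) x u = A *v trajectory A B k x u + B *v u k"
proof -
  have "(\<Sum>i<k. matrix_power A (Suc k - 1 - i) *v (B *v u i)) =
        (\<Sum>i<k. A *v (matrix_power A (k - 1 - i) *v (B *v u i)))"
  proof (rule sum.cong)
    fix i assume "i \<in> {..<k}"
    then have "Suc k - 1 - i = Suc (k - 1 - i)"
      by auto
    then show "matrix_power A (Suc k - 1 - i) *v (B *v u i) =
        A *v (matrix_power A (k - 1 - i) *v (B *v u i))"
      by (simp add: matrix_power_Suc matrix_vector_mul_assoc matrix_mul_assoc)
  qed simp
  moreover have "matrix_power A 0 *v (B *v u k) = B *v u k"
    by (simp add: matrix_power_def)
  ultimately show ?thesis
    by (simp add: trajectory_def matrix_power_Suc matrix_vector_right_distrib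
        matrix_vector_mul_assoc vec.sum)
qed

lemma trajectory_add:
  "trajectory A B (j + k) x u = trajectory A B k (trajectory A B j x u) (\<lambda>i. u (i + j))"
  by (induction k) (simp_all add: trajectory_Suc add.commute)

lemma trajectory_cong:
  assumes "\<And>i. i < k \<Longrightarrow> u i = v i"
  shows "trajectory A B k x u = trajectory A B k x v"
  using assms by (induction k) (simp_all add: trajectory_Suc)

lemma trajectory_combination:
  "trajectory A B k (a *\<^sub>R x + b *\<^sub>R y) (\<lambda>i. a *\<^sub>R u i + b *\<^sub>R v i) =
   a *\<^sub>R trajectory A B k x u + b *\<^sub>R trajectory A B k y v"
  by (induction k)
    (simp_all add: trajectory_Suc algebra_simps)

lemma continuous_on_trajectory:
  "continuous_on S (\<lambda>x. trajectory A B k x u)"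
proof (induction k)
  case (Suc k)
  then have "continuous_on S (\<lambda>x. A *v trajectory A B k x u)"
    by (rule linear_continuous_on_compose) simp
  then show ?case
    by (auto simp: trajectory_Suc intro: continuous_on_add)
qed simp

section \<open>Concatenated controls and transitivity of reachability\<close>

definition concat_controls :: "nat \<Rightarrow> (nat \<Rightarrow> 'a) \<Rightarrow> (nat \<Rightarrow> 'a) \<Rightarrow> nat \<Rightarrow> 'a" where
  "concat_controls k u v = (\<lambda>i. if i < k then u i else v (i - k))"

lemma concat_controls_admissible:
  "u \<in> admissible_controls U \<Longrightarrow> v \<in> admissible_controls U \<Longrightarrow>
   concat_controls k u v \<in> admissible_controls U"
  by (simp add: admissible_controls_def concat_controls_def)

lemma shift_admissible:
  "u \<in> admissible_controls U \<Longrightarrow> (\<lambda>i. u (i + j)) \<in> admissible_controls U"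
  by (simp add: admissible_controls_def)

lemma trajectory_concat_left:
  "j \<le> k \<Longrightarrow> trajectory A B j x (concat_controls k u v) = trajectory A B j x u"
  by (rule trajectory_cong) (simp add: concat_controls_def)

lemma trajectory_concat:
  "trajectory A B (k + l) x (concat_controls k u v) = trajectory A B l (trajectory A B k x u) v"
proof -
  have "(\<lambda>i. concat_controls k u v (i + k)) = v"
    by (simp add: concat_controls_def)
  then show ?thesis
    by (simp add: trajectory_add trajectory_concat_left)
qed

lemma reachable_set_trans:
  assumes "y \<in> reachable_set A B U x" "z \<in> reachable_set A B U y"
  shows "z \<in> reachable_set A B U x"
proof -
  obtain k u l v where "y = trajectory A B k x u" "1 \<le> k" "u \<in> admissible_controls U"
    "z = trajectory A B l y v" "v \<in> admissible_controls U"
    using assms by (auto simp: reachable_set_def)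
  then have "z = trajectory A B (k + l) x (concat_controls k u v)" "1 \<le> k + l"
    "concat_controls k u v \<in> admissible_controls U"
    by (simp_all add: trajectory_concat concat_controls_admissible)
  then show ?thesis
    unfolding reachable_set_def by blast
qed

text \<open>For one fixed control the end state depends continuously on the initial state, so limits
  of reachable points are sent to limits of reachable points.\<close>

lemma closure_reachable_set_trans:
  assumes "y \<in> closure (reachable_set A B U x)" "z \<in> reachable_set A B U y"
  shows "z \<in> closure (reachable_set A B U x)"
proof -
  obtain k u where k: "z = trajectory A B k y u" "1 \<le> k" "u \<in> admissible_controls U"
    using assms(2) by (auto simp: reachable_set_def)
  have "(\<lambda>y. trajectory A B k y u) ` closure (reachable_set A B U x)
        \<subseteq> closure (reachable_set A B U x)"
  proof (rule image_closure_subset)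
    show "(\<lambda>y. trajectory A B k y u) ` reachable_set A B U x \<subseteq> closure (reachable_set A B U x)"
    proof clarify
      fix y assume "y \<in> reachable_set A B U x"
      moreover have "trajectory A B k y u \<in> reachable_set A B U y"
        using k by (auto simp: reachable_set_def)
      ultimately show "trajectory A B k y u \<in> closure (reachable_set A B U x)"
        by (meson closure_subset reachable_set_trans subsetD)
    qed
  qed (simp_all add: continuous_on_trajectory)
  then show ?thesis
    using assms(1) k(1) by blast
qed

lemma trajectory_in_reachable_set:
  "1 \<le> k \<Longrightarrow> u \<in> admissible_controls U \<Longrightarrow> trajectory A B k x u \<in> reachable_set A B U x"
  by (auto simp: reachable_set_def)

text \<open>Adjoining the intermediate states to \<open>D\<close> keeps both control set properties:
  each of them is reached from \<open>x\<close> and leads on to a point of \<open>D\<close>.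
  Maximality then forces them into \<open>D\<close>.\<close>

lemma control_set_contains_connecting_trajectory:
  assumes D: "control_set A B U D" and x: "x \<in> D"
    and u: "u \<in> admissible_controls U" and end_in: "trajectory A B k x u \<in> D" and "j \<le> k"
  shows "trajectory A B j x u \<in> D"
proof -
  let ?R = "reachable_set A B U"
  \<comment> \<open>Only strictly intermediate times: both end states lie in \<open>D\<close>
    already.\<close>
  define T where "T = (\<lambda>j. trajectory A B j x u) ` {0<..<k}"
  have pre: "pre_control_set A B U D"
    using D by (simp add: control_set_def)
  have reach: "D \<subseteq> closure (?R y)" if "y \<in> D" for y
    using pre that by (auto simp: pre_control_set_def)
  have T_reached: "z \<in> ?R x" if "z \<in> T" for z
    using that u by (auto simp: T_def intro: trajectory_in_reachable_set)
  have T_to_end: "\<exists>l v. 1 \<le> l \<and> v \<in> admissible_controls U \<and> trajectory A B l y v = trajectory A B k x u \<and>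
      (\<forall>i<l. trajectory A B i y v \<in> T)" if y: "y \<in> T" for y
  proof -
    obtain j where j: "0 < j" "j < k" "y = trajectory A B j x u"
      using y by (auto simp: T_def)
    have *: "trajectory A B i y (\<lambda>i. u (i + j)) = trajectory A B (j + i) x u" for i
      by (simp add: trajectory_add j)
    have "\<forall>i<k - j. trajectory A B i y (\<lambda>i. u (i + j)) \<in> T"
      unfolding * T_def using j by auto
    moreover have "trajectory A B (k - j) y (\<lambda>i. u (i + j)) = trajectory A B k x u"
      unfolding * using j by simp
    ultimately show ?thesis
      using j u by (intro exI[of _ "k - j"] exI[of _ "\<lambda>i. u (i + j)"]) (auto intro: shift_admissible)
  qed
  have D_closure: "D \<subseteq> closure (?R y)" if "y \<in> D \<union> T" for y
  proof (cases "y \<in> D")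
    case False
    then have "y \<in> T"
      using that by simp
    then have "trajectory A B k x u \<in> ?R y"
      using T_to_end[of y] trajectory_in_reachable_set by metis
    then have "?R (trajectory A B k x u) \<subseteq> ?R y"
      using reachable_set_trans by blast
    then show ?thesis
      using reach[OF end_in] closure_mono by blast
  qed (use reach in auto)
  have "pre_control_set A B U (D \<union> T)"
    unfolding pre_control_set_def
  proof (intro conjI ballI)
    fix y assume y: "y \<in> D \<union> T"
    \<comment> \<open>From \<open>y\<close> the point \<open>x\<close> is approached as a limit;
      from \<open>x\<close> the points of \<open>T\<close> are reached exactly.\<close>
    have "T \<subseteq> closure (?R y)"
    proof
      fix z assume "z \<in> T"
      then show "z \<in> closure (?R y)"
        using T_reached D_closure[OF y] x closure_reachable_set_trans by blast
    qed
    then show "D \<union> T \<subseteq> closure (?R y)"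
      using D_closure[OF y] by simp
  next
    fix y assume y: "y \<in> D \<union> T"
    have stay: "\<exists>u\<in>admissible_controls U. \<forall>k\<ge>1. trajectory A B k y u \<in> D" if "y \<in> D" for y
      using pre that by (auto simp: pre_control_set_def)
    show "\<exists>u\<in>admissible_controls U. \<forall>k\<ge>1. trajectory A B k y u \<in> D \<union> T"
    proof (cases "y \<in> D")
      case False
      then obtain l v where v: "1 \<le> l" "v \<in> admissible_controls U"
        "trajectory A B l y v = trajectory A B k x u" "\<forall>i<l. trajectory A B i y v \<in> T"
        using T_to_end[of y] y by auto
      obtain w where w: "w \<in> admissible_controls U"
        "\<forall>i\<ge>1. trajectory A B i (trajectory A B k x u) w \<in> D"
        using stay[OF end_in] by auto
      \<comment> \<open>Before time \<open>l\<close> the state runs through \<open>T\<close>; from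
        the end point on, \<open>w\<close> holds it in \<open>D\<close>.\<close>
      have "trajectory A B i y (concat_controls l v w) \<in> D \<union> T" for i
      proof (cases "i < l")
        case True
        then show ?thesis
          using v by (simp add: trajectory_concat_left)
      next
        case False
        then have "trajectory A B i y (concat_controls l v w) =
            trajectory A B (i - l) (trajectory A B k x u) w"
          using trajectory_concat[of A B l "i - l"] v(3) by simp
        then show ?thesis
          using w(2) end_in False by (cases "i = l") auto
      qed
      then show ?thesis
        using v w concat_controls_admissible by blast
    qed (use stay in fastforce)
  qed
  then have "T \<subseteq> D"
    using D unfolding control_set_def by blast
  moreover have "j = 0 \<or> j = k \<or> j \<in> {0<..<k}"
    using \<open>j \<le> k\<close> by auto
  ultimately show ?thesis
    using x end_in by (auto simp: T_def)
qed

section \<open>Eigenvalues of modulus one\<close>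

lemma kalman_matrix_mult:
  fixes A :: "real^'d^'d" and B :: "real^'m^'d"
  shows "kalman_matrix A B *v s =
    (\<Sum>a\<in>UNIV. matrix_power A (to_nat_on (UNIV :: 'd set) a) *v (B *v (\<chi> m. s $ (a, m))))"
proof -
  have "(kalman_matrix A B *v s) $ i =
    (\<Sum>a\<in>UNIV. \<Sum>m\<in>UNIV. (matrix_power A (to_nat_on (UNIV :: 'd set) a) ** B) $ i $ m * s $ (a, m))" for i
    unfolding kalman_matrix_def matrix_vector_mult_def sum.cartesian_product
    by (simp add: case_prod_beta)
  then show ?thesis
    by (simp add: vec_eq_iff matrix_vector_mul_assoc) (simp add: matrix_vector_mult_def)
qed

lemma norm_pair_slice_le:
  fixes s :: "real^('a::finite \<times> 'b::finite)"
  shows "norm (\<chi> m. s $ (a, m)) \<le> norm s"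
proof -
  have "(\<Sum>m\<in>UNIV. (s $ (a, m))\<^sup>2) = (\<Sum>p\<in>Pair a ` UNIV. (s $ p)\<^sup>2)"
    by (subst sum.reindex) (auto simp: inj_on_def)
  also have "\<dots> \<le> (\<Sum>p\<in>UNIV. (s $ p)\<^sup>2)"
    by (rule sum_mono2) auto
  finally show ?thesis
    by (simp add: norm_vec_def L2_set_def)
qed

text \<open>Full rank makes the Kalman map surjective, hence open, so the image of a small ball
  contains a ball around \<open>0\<close>. The blocks of a preimage serve as control values and lie
  in \<open>U\<close> because they are small.\<close>

lemma controllable_reaches_neighbourhood:
  fixes A :: "real^'d^'d" and B :: "real^'m^'d"
  assumes "controllable A B" and "0 \<in> interior U"
  obtains r where "0 < r"
    "\<And>y. norm y < r \<Longrightarrow> \<exists>u\<in>admissible_controls U. trajectory A B CARD('d) 0 u = y"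
proof -
  obtain e where e: "0 < e" "ball 0 e \<subseteq> U"
    using assms(2) by (auto simp: mem_interior)
  let ?K = "kalman_matrix A B"
  have "surj ((*v) ?K)"
    using assms(1) by (simp add: controllable_def full_rank_surjective)
  then have "open ((*v) ?K ` ball 0 e)"
    by (intro open_surjective_linear_image) auto
  moreover have "0 \<in> (*v) ?K ` ball 0 e"
    using e(1) by (force intro!: image_eqI[of _ _ 0])
  ultimately obtain r where r: "0 < r" "ball 0 r \<subseteq> (*v) ?K ` ball 0 e"
    by (meson openE)
  have "\<exists>u\<in>admissible_controls U. trajectory A B CARD('d) 0 u = y" if y: "norm y < r" for y
  proof -
    obtain s where s: "norm s < e" "y = ?K *v s"
      using r(2) y by (force simp: subset_iff image_iff)
    let ?d = "CARD('d)"
    define w where "w j = (\<chi> m. s $ (from_nat_into (UNIV :: 'd set) j, m))" for j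
    \<comment> \<open>The blocks are applied in reverse order, since the control at time
      \<open>i\<close> is multiplied by the power \<open>?d - 1 - i\<close> of
      \<open>A\<close>.\<close>
    let ?u = "\<lambda>i. w (?d - 1 - i)"
    have "norm (w j) < e" for j
      using norm_pair_slice_le[of s "from_nat_into UNIV j"] s(1) by (simp add: w_def)
    then have "?u \<in> admissible_controls U"
      using e(2) by (auto simp: admissible_controls_def)
    moreover have "trajectory A B ?d 0 ?u = y"
    proof -
      have "trajectory A B ?d 0 ?u = (\<Sum>i<?d. matrix_power A (?d - Suc i) *v (B *v w (?d - Suc i)))"
        by (simp add: trajectory_def)
      also have "\<dots> = (\<Sum>j<?d. matrix_power A j *v (B *v w j))"
        by (rule sum.nat_diff_reindex)
      also have "\<dots> = (\<Sum>a\<in>UNIV. matrix_power A (to_nat_on (UNIV :: 'd set) a) *v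
          (B *v w (to_nat_on (UNIV :: 'd set) a)))"
        by (rule sum.reindex_bij_betw[symmetric]) (simp add: to_nat_on_finite)
      also have "\<dots> = y"
        by (simp add: s(2) kalman_matrix_mult w_def from_nat_into_to_nat_on countable_finite)
      finally show ?thesis .
    qed
    ultimately show ?thesis
      by blast
  qed
  with r(1) that show ?thesis
    by blast
qed

section \<open>The real eigenspace, parametrised by real parts of complex multiples of
  \<open>v\<close>\<close>

definition Re_scaled :: "complex^'d \<Rightarrow> complex \<Rightarrow> real^'d" where
  "Re_scaled v c = (\<chi> i. Re (c * v $ i))"

lemma Re_scaled_add: "Re_scaled v (a + b) = Re_scaled v a + Re_scaled v b"
  by (simp add: Re_scaled_def vec_eq_iff algebra_simps)

lemma Re_scaled_scaleR: "Re_scaled v (t *\<^sub>R c) = t *\<^sub>R Re_scaled v c"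
  by (simp add: Re_scaled_def vec_eq_iff algebra_simps)

lemma linear_Re_scaled: "linear (Re_scaled v)"
  by (rule linearI) (simp_all add: Re_scaled_add Re_scaled_scaleR)

text \<open>The witness is the conjugate of a nonzero entry, which turns that entry into its squared
  modulus.\<close>

lemma Re_scaled_nonzero:
  assumes "v \<noteq> 0"
  obtains c where "Re_scaled v c \<noteq> 0"
proof -
  obtain i where "v $ i \<noteq> 0"
    using assms by (auto simp: vec_eq_iff)
  then have "Re_scaled v (cnj (v $ i)) $ i \<noteq> 0"
    by (simp add: Re_scaled_def complex_eq_iff flip: power2_eq_square)
  then show ?thesis
    using that by fastforce
qed

text \<open>\<open>A\<close> is real, so it commutes with taking real parts and acts on the
  parameter \<open>c\<close> as multiplication by \<open>\<mu>\<close>.\<close>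

lemma matrix_mult_Re_scaled:
  assumes "map_matrix complex_of_real A *v v = \<mu> *s v"
  shows "A *v Re_scaled v c = Re_scaled v (c * \<mu>)"
proof -
  have "(A *v Re_scaled v c) $ i = Re_scaled v (c * \<mu>) $ i" for i
  proof -
    have "(A *v Re_scaled v c) $ i = Re (\<Sum>j\<in>UNIV. complex_of_real (A $ i $ j) * (c * v $ j))"
      by (simp add: matrix_vector_mult_def Re_scaled_def)
    also have "(\<Sum>j\<in>UNIV. complex_of_real (A $ i $ j) * (c * v $ j)) =
        c * (map_matrix complex_of_real A *v v) $ i"
      by (simp add: matrix_vector_mult_def map_matrix_def sum_distrib_left algebra_simps)
    also have "\<dots> = c * \<mu> * v $ i"
      by (simp add: assms)
    finally show ?thesis
      by (simp add: Re_scaled_def)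
  qed
  then show ?thesis
    by (simp add: vec_eq_iff)
qed

lemma trajectory_superposition:
  "trajectory A B k (x + y) (\<lambda>i. u i + v i) = trajectory A B k x u + trajectory A B k y v"
  using trajectory_combination[of A B k 1 x 1 y u v] by simp

lemma trajectory_zero_control_Re_scaled:
  assumes "map_matrix complex_of_real A *v v = \<mu> *s v"
  shows "trajectory A B k (Re_scaled v c) (\<lambda>_. 0) = Re_scaled v (c * \<mu> ^ k)"
  by (induction k) (simp_all add: trajectory_Suc matrix_mult_Re_scaled[OF assms] mult_ac)

text \<open>Since \<open>|\<mu>| = 1\<close>, the matrix rotates the disc \<open>Re_scaled v ` cball 0 r\<close> into itself. Hence
  blocks of \<open>d\<close> steps that each reach the disc from \<open>0\<close> add up to discs of any radius.\<close>

lemma unit_eigenvalue_reaches: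
  fixes A :: "real^'d^'d" and B :: "real^'m^'d"
  assumes "controllable A B" "0 \<in> interior U"
    and ev: "map_matrix complex_of_real A *v v = \<mu> *s v" and \<mu>: "cmod \<mu> = 1"
  obtains n where "\<And>c. cmod c \<le> C \<Longrightarrow>
    \<exists>u\<in>admissible_controls U. trajectory A B n 0 u = Re_scaled v c"
proof -
  let ?d = "CARD('d)"
  obtain r where r: "0 < r"
    "\<And>y. norm y < r \<Longrightarrow> \<exists>u\<in>admissible_controls U. trajectory A B ?d 0 u = y"
    using controllable_reaches_neighbourhood[OF assms(1,2)] by metis
  obtain M where M: "0 < M" "\<And>c. norm (Re_scaled v c) \<le> M * norm c"
    using linear_bounded_pos[OF linear_Re_scaled] by metis
  \<comment> \<open>This makes \<open>M * \<rho>\<close> equal to \<open>r / 2\<close>, safely below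
    \<open>r\<close>.\<close>
  define \<rho> where "\<rho> = r / (2 * M)"
  have "0 < \<rho>"
    using r M by (simp add: \<rho>_def)
  have disc: "\<exists>u\<in>admissible_controls U. trajectory A B ?d 0 u = Re_scaled v c" if "cmod c \<le> \<rho>" for c
  proof (rule r(2))
    have "norm (Re_scaled v c) \<le> M * \<rho>"
      using M that by (meson less_imp_le mult_left_mono order_trans)
    also have "\<dots> < r"
      using r M by (simp add: \<rho>_def)
    finally show "norm (Re_scaled v c) < r" .
  qed
  have reach: "\<exists>u\<in>admissible_controls U. trajectory A B (n * ?d) 0 u = Re_scaled v c"
    if "cmod c \<le> real n * \<rho>" for n c
    using that
  proof (induction n arbitrary: c)
    case 0
    have "(\<lambda>_. 0) \<in> admissible_controls U"
      using assms(2) interior_subset by (force simp: admissible_controls_def)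
    with 0 show ?case
      by (auto simp: Re_scaled_def vec_eq_iff)
  next
    case (Suc n)
    \<comment> \<open>The target is split into \<open>Suc n\<close> equal parts: \<open>n\<close> of
      them come from the earlier blocks and one from the last.\<close>
    define a where "a = c / of_nat (Suc n)"
    have "c = of_nat (Suc n) * a"
      unfolding a_def by (simp del: of_nat_Suc)
    then have c: "c = of_nat n * a + a"
      by (simp add: distrib_right)
    have a: "cmod a \<le> \<rho>"
      using Suc.prems by (simp add: a_def norm_divide field_simps norm_of_nat del: of_nat_Suc)
    have \<mu>0: "\<mu> \<noteq> 0"
      using \<mu> by auto
    \<comment> \<open>Division by \<open>\<mu> ^ ?d\<close> compensates in advance for the free
      motion during the last block and does not change the modulus.\<close>
    have "cmod (of_nat n * a / \<mu> ^ ?d) \<le> real n * \<rho>"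
      using a \<mu> by (simp add: norm_mult norm_divide norm_power mult_left_mono)
    then obtain u where u: "u \<in> admissible_controls U"
      "trajectory A B (n * ?d) 0 u = Re_scaled v (of_nat n * a / \<mu> ^ ?d)"
      using Suc.IH by blast
    obtain w where w: "w \<in> admissible_controls U" "trajectory A B ?d 0 w = Re_scaled v a"
      using disc[OF a] by blast
    have "trajectory A B (Suc n * ?d) 0 (concat_controls (n * ?d) u w) =
        trajectory A B ?d (Re_scaled v (of_nat n * a / \<mu> ^ ?d) + 0) (\<lambda>i. 0 + w i)"
      using trajectory_concat[of A B "n * ?d" ?d] u(2) by (simp add: add.commute)
    also have "\<dots> = Re_scaled v c"
      unfolding trajectory_superposition trajectory_zero_control_Re_scaled[OF ev] w(2)
      using \<mu>0 by (simp add: c flip: Re_scaled_add)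
    finally show ?case
      using u w concat_controls_admissible by blast
  qed
  obtain n where "C \<le> real n * \<rho>"
    using \<open>0 < \<rho>\<close> ex_less_of_nat_mult less_imp_le by blast
  then show ?thesis
    using that[of "n * ?d"] reach order_trans by blast
qed

text \<open>For the way back, the free motion turns the parameter \<open>c\<close> into
  \<open>c * \<mu> ^ n\<close>, and by superposition a second control cancels it. Resting at
  \<open>0\<close> afterwards gives loops of every length from \<open>2 * n\<close> on, so
  \<open>n\<close> can be fixed before the length is known.\<close>

lemma unit_eigenvalue_loops:
  fixes A :: "real^'d^'d" and B :: "real^'m^'d"
  assumes "controllable A B" "0 \<in> interior U"
    and ev: "map_matrix complex_of_real A *v v = \<mu> *s v" and \<mu>: "cmod \<mu> = 1"
  obtains n where "\<And>c k. cmod c \<le> C \<Longrightarrow> 2 * n \<le> k \<Longrightarrow>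
    \<exists>u\<in>admissible_controls U. trajectory A B n 0 u = Re_scaled v c \<and> trajectory A B k 0 u = 0"
proof -
  obtain n where n: "\<And>c. cmod c \<le> C \<Longrightarrow>
    \<exists>u\<in>admissible_controls U. trajectory A B n 0 u = Re_scaled v c"
    using unit_eigenvalue_reaches[OF assms] by metis
  have "\<exists>u\<in>admissible_controls U. trajectory A B n 0 u = Re_scaled v c \<and> trajectory A B k 0 u = 0"
    if c: "cmod c \<le> C" and k: "2 * n \<le> k" for c k
  proof -
    obtain u where u: "u \<in> admissible_controls U" "trajectory A B n 0 u = Re_scaled v c"
      using n[OF c] by blast
    have "cmod (- c * \<mu> ^ n) \<le> C"
      using c \<mu> by (simp add: norm_mult norm_power)
    then obtain w where w: "w \<in> admissible_controls U"
      "trajectory A B n 0 w = Re_scaled v (- c * \<mu> ^ n)"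
      using n by blast
    have zero: "(\<lambda>_. 0) \<in> admissible_controls U"
      using assms(2) interior_subset by (force simp: admissible_controls_def)
    let ?w = "concat_controls n w (\<lambda>_. 0)"
    let ?u = "concat_controls n u ?w"
    have "trajectory A B n (Re_scaled v c + 0) (\<lambda>i. 0 + w i) = 0"
      unfolding trajectory_superposition trajectory_zero_control_Re_scaled[OF ev] w(2)
      by (simp add: Re_scaled_def vec_eq_iff)
    then have return0: "trajectory A B n (Re_scaled v c) w = 0"
      by simp
    have rest: "trajectory A B j 0 (\<lambda>_. 0) = 0" for j
      by (simp add: trajectory_def)
    have "k = n + (n + (k - 2 * n))"
      using k by simp
    then have "trajectory A B k 0 ?u = 0"
      by (metis trajectory_concat u(2) return0 rest)
    moreover have "trajectory A B n 0 ?u = Re_scaled v c"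
      using u by (simp add: trajectory_concat_left)
    ultimately show ?thesis
      using u w zero concat_controls_admissible by blast
  qed
  then show ?thesis
    using that by blast
qed

text \<open>From any point of \<open>V\<close>, \<open>x\<close> is in the closure of the reachable
  set, so the open set \<open>V\<close> is hit again after at least one further step. Iteration
  makes the return time as large as desired.\<close>

lemma control_set_return_late:
  assumes D: "control_set A B U D" and "open V" "V \<subseteq> D" "x \<in> V"
  shows "\<exists>k\<ge>n. \<exists>u\<in>admissible_controls U. trajectory A B k x u \<in> V"
proof (induction n)
  case 0
  have "x \<in> D"
    using assms by blast
  then obtain u where "u \<in> admissible_controls U"
    using D unfolding control_set_def pre_control_set_def by blast
  then show ?case
    using \<open>x \<in> V\<close> by (intro exI[of _ 0]) auto
next
  case (Suc n)
  then obtain k u where u: "n \<le> k" "u \<in> admissible_controls U" "trajectory A B k x u \<in> V"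
    by blast
  let ?y = "trajectory A B k x u"
  have "x \<in> closure (reachable_set A B U ?y)"
    using D u(3) assms(3,4) unfolding control_set_def pre_control_set_def by blast
  then obtain z where "z \<in> reachable_set A B U ?y" "z \<in> V"
    using \<open>open V\<close> \<open>x \<in> V\<close> by (meson disjoint_iff open_Int_closure_eq_empty)
  then obtain l w where w: "1 \<le> l" "w \<in> admissible_controls U" "trajectory A B l ?y w \<in> V"
    by (auto simp: reachable_set_def)
  then have "trajectory A B (k + l) x (concat_controls k u w) \<in> V"
    by (simp add: trajectory_concat)
  moreover have "concat_controls k u w \<in> admissible_controls U"
    using u(2) w(2) by (rule concat_controls_admissible)
  moreover have "Suc n \<le> k + l"
    using u(1) w(1) by simp
  ultimately show ?case
    by blast
qed

text \<open>A trajectory that returns close to its interior starting point is averaged with loops at \<open>0\<close>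
  through \<open>\<plusminus> p\<close>. Both averages connect points of the control set, and they differ by a fixed
  multiple of \<open>p\<close>.\<close>

lemma bounded_control_set_imp_hyperbolic:
  fixes A :: "real^'d^'d" and B :: "real^'m^'d"
  assumes "convex U" "0 \<in> interior U" "controllable A B"
    and D: "control_set A B U D" and "interior D \<noteq> {}" and "bounded D"
  shows "hyperbolic A"
  unfolding hyperbolic_def
proof (intro allI impI notI)
  fix \<mu> assume "eigenvalue A \<mu>" and \<mu>: "cmod \<mu> = 1"
  then obtain v where v: "v \<noteq> 0" "map_matrix complex_of_real A *v v = \<mu> *s v"
    by (auto simp: eigenvalue_def)
  obtain c0 where c0: "Re_scaled v c0 \<noteq> 0"
    using Re_scaled_nonzero[OF v(1)] .
  obtain M where M: "\<And>y. y \<in> D \<Longrightarrow> norm y \<le> M"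
    using \<open>bounded D\<close> by (auto simp: bounded_iff)
  obtain x where "x \<in> interior D"
    using assms by blast
  then obtain \<delta>' where \<delta>': "0 < \<delta>'" "ball x \<delta>' \<subseteq> D"
    by (auto simp: mem_interior)
  \<comment> \<open>Half of the radius is spent on the return close to \<open>x\<close>, the other
    half on the shrinking by \<open>1 - \<epsilon>\<close>.\<close>
  define \<delta> where "\<delta> = \<delta>' / 2"
  have \<delta>: "0 < \<delta>" "ball x (2 * \<delta>) \<subseteq> D"
    using \<delta>' by (simp_all add: \<delta>_def)
  \<comment> \<open>The denominator bounds the norm on \<open>ball x \<delta>\<close>, so scaling by
    \<open>1 - \<epsilon>\<close> moves its points by at most \<open>\<delta>\<close>.\<close>
  define \<epsilon> where "\<epsilon> = \<delta> / (norm x + 2 * \<delta>)"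
  have den: "0 < norm x + 2 * \<delta>"
    using \<delta> norm_ge_zero[of x] by linarith
  have \<epsilon>: "0 < \<epsilon>" "\<epsilon> \<le> 1"
    using \<delta> den by (auto simp: \<epsilon>_def)
  have shrink: "(1 - \<epsilon>) *\<^sub>R y \<in> D" if "y \<in> ball x \<delta>" for y
  proof -
    have "norm y \<le> norm x + norm (y - x)"
      by (rule norm_triangle_sub)
    also have "\<dots> \<le> norm x + 2 * \<delta>"
      using that \<delta> by (simp add: dist_norm norm_minus_commute)
    finally have "\<epsilon> * norm y \<le> \<epsilon> * (norm x + 2 * \<delta>)"
      using \<epsilon> by simp
    also have "\<dots> = \<delta>"
      using den by (simp add: \<epsilon>_def)
    finally have "dist y ((1 - \<epsilon>) *\<^sub>R y) \<le> \<delta>"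
      using \<epsilon> by (simp add: dist_norm algebra_simps)
    then have "dist x ((1 - \<epsilon>) *\<^sub>R y) < 2 * \<delta>"
      using that dist_triangle[of x "(1 - \<epsilon>) *\<^sub>R y" y] by simp
    then show ?thesis
      using \<delta> by auto
  qed
  \<comment> \<open>Chosen so that \<open>?y + ?p\<close> and \<open>?y - ?p\<close> below are
    \<open>2 * (M + 1)\<close> apart, too far for two points of norm at most
    \<open>M\<close>.\<close>
  define t where "t = (M + 1) / (\<epsilon> * norm (Re_scaled v c0))"
  let ?c = "t *\<^sub>R c0"
  obtain n where n: "\<And>c k. cmod c \<le> cmod ?c \<Longrightarrow> 2 * n \<le> k \<Longrightarrow>
    \<exists>u\<in>admissible_controls U. trajectory A B n 0 u = Re_scaled v c \<and> trajectory A B k 0 u = 0"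
    using unit_eigenvalue_loops[OF assms(3,2) v(2) \<mu>] by metis
  have "ball x \<delta> \<subseteq> D"
    using \<delta> by auto
  \<comment> \<open>Waiting until \<open>2 * n\<close> leaves room for loops at \<open>0\<close> of
    exactly the length \<open>k\<close>.\<close>
  then obtain k u where k: "2 * n \<le> k" and u: "u \<in> admissible_controls U"
    "trajectory A B k x u \<in> ball x \<delta>"
    using control_set_return_late[OF D open_ball, of x \<delta> x "2 * n"] \<delta> by auto
  let ?y = "(1 - \<epsilon>) *\<^sub>R trajectory A B n x u"
  have in_D: "?y + \<epsilon> *\<^sub>R Re_scaled v c \<in> D" if c: "cmod c \<le> cmod ?c" for c
  proof -
    obtain w where w: "w \<in> admissible_controls U" "trajectory A B n 0 w = Re_scaled v c"
      "trajectory A B k 0 w = 0"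
      using n[OF c k] by blast
    \<comment> \<open>Admissible by convexity of \<open>U\<close>. Since the loop starts and ends at
      \<open>0\<close>, the averaged trajectory has shrunken points of
      \<open>ball x \<delta>\<close> at both ends.\<close>
    let ?u = "\<lambda>i. (1 - \<epsilon>) *\<^sub>R u i + \<epsilon> *\<^sub>R w i"
    have traj: "trajectory A B j ((1 - \<epsilon>) *\<^sub>R x) ?u =
        (1 - \<epsilon>) *\<^sub>R trajectory A B j x u + \<epsilon> *\<^sub>R trajectory A B j 0 w" for j
      using trajectory_combination[of A B j "1 - \<epsilon>" x \<epsilon> 0 u w] by simp
    have "trajectory A B n ((1 - \<epsilon>) *\<^sub>R x) ?u \<in> D"
    proof (rule control_set_contains_connecting_trajectory[OF D])
      show "?u \<in> admissible_controls U"
        using u w \<epsilon> \<open>convex U\<close> by (auto simp: admissible_controls_def intro!: convexD)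
      show "trajectory A B k ((1 - \<epsilon>) *\<^sub>R x) ?u \<in> D"
        unfolding traj using shrink u w by simp
    qed (use shrink \<delta> k in auto)
    then show ?thesis
      by (simp add: traj w)
  qed
  let ?p = "\<epsilon> *\<^sub>R Re_scaled v ?c"
  have "norm (?y + ?p) \<le> M" "norm (?y - ?p) \<le> M"
    using M[OF in_D[of ?c]] M[OF in_D[of "- ?c"]] Re_scaled_scaleR[of v "-1" ?c] by simp_all
  then have "norm ((?y + ?p) - (?y - ?p)) \<le> 2 * M"
    using norm_triangle_ineq4[of "?y + ?p" "?y - ?p"] by linarith
  moreover have "(?y + ?p) - (?y - ?p) = (2 * \<epsilon> * t) *\<^sub>R Re_scaled v c0"
    by (simp add: vec_eq_iff Re_scaled_scaleR)
  ultimately have "2 * (\<epsilon> * \<bar>t\<bar> * norm (Re_scaled v c0)) \<le> 2 * M"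
    using \<epsilon> by (simp only: norm_scaleR) (simp add: abs_mult)
  moreover have "\<epsilon> * t * norm (Re_scaled v c0) = M + 1"
    using \<epsilon> c0 by (simp add: t_def)
  moreover have "\<epsilon> * t * norm (Re_scaled v c0) \<le> \<epsilon> * \<bar>t\<bar> * norm (Re_scaled v c0)"
    using \<epsilon> by (intro mult_right_mono mult_left_mono) auto
  ultimately show False
    by linarith
qed

section \<open>Hyperbolic systems\<close>

definition poly_mat_vec :: "complex^'n^'n \<Rightarrow> complex poly \<Rightarrow> complex^'n \<Rightarrow> complex^'n" where
  "poly_mat_vec M p w = (\<Sum>i\<le>degree p. coeff p i *s ((*v) M ^^ i) w)"

lemma poly_mat_vec_eq:
  "degree p \<le> n \<Longrightarrow> poly_mat_vec M p w = (\<Sum>i\<le>n. coeff p i *s ((*v) M ^^ i) w)"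
  unfolding poly_mat_vec_def by (rule sum.mono_neutral_left) (auto simp: coeff_eq_0)

lemma poly_mat_vec_add: "poly_mat_vec M (p + q) w = poly_mat_vec M p w + poly_mat_vec M q w"
proof -
  let ?n = "max (degree p) (degree q)"
  have "degree (p + q) \<le> ?n"
    by (rule degree_add_le_max)
  then show ?thesis
    by (simp add: poly_mat_vec_eq[of _ ?n] sum.distrib vec.scale_left_distrib)
qed

lemma poly_mat_vec_smult: "poly_mat_vec M (smult c p) w = c *s poly_mat_vec M p w"
  by (simp add: poly_mat_vec_eq[of _ "degree p"] vec.scale_sum_right)

lemma poly_mat_vec_pCons_0: "poly_mat_vec M (pCons 0 p) w = M *v poly_mat_vec M p w"
proof -
  have "poly_mat_vec M (pCons 0 p) w =
      (\<Sum>i\<le>Suc (degree p). coeff (pCons 0 p) i *s ((*v) M ^^ i) w)"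
    by (rule poly_mat_vec_eq) (rule degree_pCons_le)
  also have "\<dots> = (\<Sum>i\<le>degree p. coeff p i *s (M *v ((*v) M ^^ i) w))"
    by (subst sum.atMost_Suc_shift) simp
  also have "\<dots> = M *v poly_mat_vec M p w"
    by (simp add: poly_mat_vec_def vec.sum vec.scale)
  finally show ?thesis .
qed

lemma poly_mat_vec_linear_factor:
  "poly_mat_vec M ([:- \<nu>, 1:] * q) w = M *v poly_mat_vec M q w - \<nu> *s poly_mat_vec M q w"
proof -
  have "[:- \<nu>, 1:] * q = pCons 0 q + smult (- \<nu>) q"
    by simp
  then show ?thesis
    by (simp only: poly_mat_vec_add poly_mat_vec_smult poly_mat_vec_pCons_0) simp
qed

lemma poly_mat_vec_commute:
  "poly_mat_vec M q (M *v w - \<nu> *s w) = M *v poly_mat_vec M q w - \<nu> *s poly_mat_vec M q w"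
proof -
  have "((*v) M ^^ i) (M *v w - \<nu> *s w) = M *v (((*v) M ^^ i) w) - \<nu> *s ((*v) M ^^ i) w" for i
    by (induction i) (simp_all add: vec.diff vec.scale)
  then show ?thesis
    by (simp add: poly_mat_vec_def vec.scale_right_diff_distrib sum_subtractf
        vec.sum vec.scale vec.scale_sum_right mult.commute)
qed

text \<open>The iterates of \<open>w\<close> up to exponent \<open>CARD('n)\<close> are too many to
  be independent. Dependence is stated for sets of vectors, so a repetition among the iterates is
  treated separately and gives a difference of two monomials.\<close>

lemma annihilating_poly_exists:
  fixes M :: "complex^'n^'n"
  obtains p where "p \<noteq> 0" "poly_mat_vec M p w = 0"
proof (cases "inj_on (\<lambda>i. ((*v) M ^^ i) w) {..CARD('n)}")
  case True
  let ?f = "\<lambda>i. ((*v) M ^^ i) w" and ?n = "CARD('n)"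
  let ?S = "?f ` {..?n}"
  have "vec.dim ?S < card ?S"
    using vec.dim_subset[of ?S UNIV, unfolded vec_dim_card] True
    by (simp only: card_image) simp
  then have "vec.dependent ?S"
    by (rule vec.dependent_biggerset_general)
  then obtain c where c: "\<exists>v\<in>?S. c v \<noteq> 0" "(\<Sum>v\<in>?S. c v *s v) = 0"
    by (auto simp: vec.dependent_finite)
  define p where "p = (\<Sum>i\<le>?n. monom (c (?f i)) i)"
  have coeff_p: "coeff p i = (if i \<le> ?n then c (?f i) else 0)" for i
    by (simp add: p_def coeff_sum)
  then have "degree p \<le> ?n"
    by (intro degree_le) auto
  then have "poly_mat_vec M p w = (\<Sum>i\<le>?n. c (?f i) *s ?f i)"
    by (simp add: poly_mat_vec_eq coeff_p)
  also have "\<dots> = 0"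
    using c(2) True by (simp add: sum.reindex)
  finally show ?thesis
    using that[of p] c(1) coeff_p by (metis (no_types, lifting) atMost_iff coeff_0 imageE)
next
  case False
  then obtain i j where ij: "i \<noteq> j" "((*v) M ^^ i) w = ((*v) M ^^ j) w"
    by (auto simp: inj_on_def)
  let ?p = "monom 1 i + monom (-1) j :: complex poly"
  have "coeff ?p i \<noteq> 0"
    using ij by simp
  moreover have monom: "poly_mat_vec M (monom c k) w = c *s ((*v) M ^^ k) w" for c k
    by (simp add: poly_mat_vec_eq[OF degree_monom_le] if_distrib[of "\<lambda>c. c *s _"] cong: if_cong)
  have "poly_mat_vec M ?p w = 0"
    using ij(2) unfolding poly_mat_vec_add monom by simp
  ultimately show ?thesis
    using that by (metis coeff_0)
qed

text \<open>Linear factors whose root is not an eigenvalue act injectively and can be cancelled from an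
  annihilating polynomial.\<close>

lemma annihilated_by_eigenvalue_factors:
  assumes base: "P 0"
    and step: "\<And>w \<nu> v. P (M *v w - \<nu> *s w) \<Longrightarrow> v \<noteq> 0 \<Longrightarrow> M *v v = \<nu> *s v \<Longrightarrow> P w"
  shows "P (w :: complex^'n)"
proof -
  have "P w" if "p \<noteq> 0" "poly_mat_vec M p w = 0" for p w
    using that
  proof (induction "degree p" arbitrary: p w)
    case 0
    then obtain c where "p = [:c:]" "c \<noteq> 0"
      by (metis degree_eq_zeroE pCons_0_0)
    with 0 show ?case
      using base by (simp add: poly_mat_vec_def)
  next
    case (Suc n)
    then have "\<not> constant (poly p)"
      by (simp add: constant_degree)
    then obtain \<nu> where "poly p \<nu> = 0"
      using fundamental_theorem_of_algebra by blast
    then obtain q where p: "p = [:- \<nu>, 1:] * q"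
      by (metis dvdE poly_eq_0_iff_dvd)
    then have q: "q \<noteq> 0" "n = degree q"
      using Suc by (auto simp: degree_mult_eq simp del: mult_pCons_left)
    have eq: "M *v poly_mat_vec M q w = \<nu> *s poly_mat_vec M q w"
      using Suc.prems(2) unfolding p poly_mat_vec_linear_factor by simp
    show ?case
    proof (cases "poly_mat_vec M q w = 0")
      case True
      then show ?thesis
        using Suc.hyps(1)[OF q(2,1)] by simp
    next
      case False
      \<comment> \<open>Here \<open>poly_mat_vec M q w\<close> is itself an eigenvector for
        \<open>\<nu>\<close>, so the degree drops at the price of one use of
        \<open>step\<close>.\<close>
      have "poly_mat_vec M q (M *v w - \<nu> *s w) = 0"
        using eq by (simp add: poly_mat_vec_commute)
      then show ?thesis
        using Suc.hyps(1)[OF q(2,1)] step False eq by blast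
    qed
  qed
  then show ?thesis
    using annihilating_poly_exists by metis
qed

text \<open>The pairing argument uses eigenvectors of the transpose, while hyperbolicity speaks
  about \<open>A\<close>. Transposing preserves the determinant, so the two shifted matrices are
  singular together.\<close>

lemma transpose_eigenvalue:
  assumes "v \<noteq> 0" "transpose (map_matrix complex_of_real A) *v v = \<nu> *s v"
  shows "eigenvalue A \<nu>"
proof -
  let ?N = "map_matrix complex_of_real A - mat \<nu>"
  have mat: "mat \<nu> *v x = \<nu> *s x" for x :: "complex^'a"
    by (simp add: vec_eq_iff matrix_vector_mult_def mat_def if_distrib[of "\<lambda>c. c * _"] cong: if_cong)
  have "transpose ?N = transpose (map_matrix complex_of_real A) - mat \<nu>"
    by (simp add: transpose_def mat_def vec_eq_iff)
  then have "transpose ?N *v v = 0"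
    using assms(2) by (simp add: matrix_vector_mult_diff_rdistrib mat)
  then have "\<not> invertible (transpose ?N)"
    using assms(1) by (metis invertible_def matrix_left_invertible_ker)
  then have "\<not> invertible ?N"
    by (simp add: invertible_det_nz)
  then obtain x where "x \<noteq> 0" "?N *v x = 0"
    by (metis invertible_left_inverse matrix_left_invertible_ker)
  then show ?thesis
    unfolding eigenvalue_def by (auto simp: matrix_vector_mult_diff_rdistrib mat)
qed

text \<open>A contracting factor propagates bounds forwards from \<open>z 0\<close>, an expanding
  one backwards from \<open>z k\<close>; either way the bound is independent of
  \<open>k\<close>.\<close>

lemma hyperbolic_recurrence_bound:
  fixes z :: "nat \<Rightarrow> complex"
  assumes rec: "\<And>i. i < k \<Longrightarrow> cmod (z (Suc i) - \<nu> * z i) \<le> F"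
    and ends: "cmod (z 0) \<le> R" "cmod (z k) \<le> R" and "cmod \<nu> \<noteq> 1" "0 \<le> F" "i \<le> k"
  shows "cmod (z i) \<le> R + F / \<bar>cmod \<nu> - 1\<bar>"
proof (cases "cmod \<nu> < 1")
  case True
  \<comment> \<open>\<open>G\<close> solves \<open>G = cmod \<nu> * G + F\<close>, so it absorbs the
    forcing in each step.\<close>
  define G where "G = F / \<bar>cmod \<nu> - 1\<bar>"
  have G: "0 \<le> G" "(1 - cmod \<nu>) * G = F" and "0 \<le> R"
    using assms True norm_ge_zero[of "z 0"] by (simp_all add: G_def del: norm_ge_zero)
  have "cmod (z i) \<le> R + G"
    using \<open>i \<le> k\<close>
  proof (induction i)
    case (Suc i)
    have "cmod (z (Suc i)) \<le> cmod (\<nu> * z i) + cmod (z (Suc i) - \<nu> * z i)"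
      by (rule norm_triangle_sub)
    also have "\<dots> \<le> cmod \<nu> * (R + G) + F"
      using Suc rec[of i] by (simp add: norm_mult add_mono mult_left_mono)
    also have "\<dots> = cmod \<nu> * R + G"
      using G(2) by (simp add: algebra_simps)
    also have "\<dots> \<le> R + G"
      using True \<open>0 \<le> R\<close> by (simp add: mult_left_le_one_le)
    finally show ?case .
  qed (use ends G in simp)
  then show ?thesis
    by (simp add: G_def)
next
  case False
  define G where "G = F / \<bar>cmod \<nu> - 1\<bar>"
  have G: "0 \<le> G" "(cmod \<nu> - 1) * G = F" and "0 \<le> R" and gt: "1 < cmod \<nu>"
    using assms False norm_ge_zero[of "z 0"] by (simp_all add: G_def del: norm_ge_zero)
  have "cmod (z i) \<le> R + G"
    using \<open>i \<le> k\<close>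
  proof (induction i rule: inc_induct)
    case (step i)
    have "cmod \<nu> * cmod (z i) = cmod (\<nu> * z i)"
      by (simp add: norm_mult)
    also have "\<dots> \<le> cmod (z (Suc i)) + cmod (\<nu> * z i - z (Suc i))"
      by (rule norm_triangle_sub)
    also have "\<dots> \<le> R + G + F"
      using step rec[of i] by (simp add: norm_minus_commute)
    also have "\<dots> = R + cmod \<nu> * G"
      using G(2) by (simp add: algebra_simps)
    also have "\<dots> \<le> cmod \<nu> * (R + G)"
      using gt \<open>0 \<le> R\<close> by (simp add: distrib_left mult_left_mono[of 1 "cmod \<nu>" R, simplified] mult.commute)
    finally show ?case
      by (rule mult_left_le_imp_le) (use gt in linarith)
  qed (use ends G in simp)
  then show ?thesis
    by (simp add: G_def)
qed

section \<open>Pairing with complex dual vectors\<close>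

definition pairing :: "complex^'n \<Rightarrow> real^'n \<Rightarrow> complex" where
  "pairing w x = (\<Sum>i\<in>UNIV. w $ i * of_real (x $ i))"

lemma pairing_add_right: "pairing w (x + y) = pairing w x + pairing w y"
  by (simp add: pairing_def algebra_simps sum.distrib)

lemma pairing_eigen_diff: "pairing (v - \<nu> *s w) x = pairing v x - \<nu> * pairing w x"
  by (simp add: pairing_def algebra_simps sum_subtractf sum_distrib_left)

text \<open>As the pairing does not conjugate, an eigenvector of the transpose for
  \<open>\<nu>\<close> yields a recurrence with factor \<open>\<nu>\<close> itself.\<close>

lemma pairing_matrix_mult:
  "pairing w (A *v x) = pairing (transpose (map_matrix complex_of_real A) *v w) x"
  unfolding pairing_def matrix_vector_mult_def transpose_def map_matrix_def
  by (simp add: sum_distrib_left sum_distrib_right mult_ac) (rule sum.swap)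

lemma pairing_bound:
  obtains C where "0 \<le> C" "\<And>x. cmod (pairing w x) \<le> C * norm x"
proof
  show "0 \<le> (\<Sum>i\<in>UNIV. cmod (w $ i))"
    by (simp add: sum_nonneg)
  show "cmod (pairing w x) \<le> (\<Sum>i\<in>UNIV. cmod (w $ i)) * norm x" for x
    unfolding pairing_def sum_distrib_right
    by (rule order_trans[OF norm_sum sum_mono])
      (simp add: norm_mult mult_left_mono component_le_norm_cart)
qed

text \<open>The pairing with a vector in a Jordan chain of \<open>A\<^sup>T\<close> satisfies a scalar recurrence with bounded
  forcing. It is controlled from the initial point if \<open>|\<nu>| < 1\<close> and from the end point if \<open>|\<nu>| > 1\<close>.\<close>

lemma hyperbolic_pairing_bound:
  fixes A :: "real^'d^'d" and B :: "real^'m^'d"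
  assumes "hyperbolic A" "bounded U"
  shows "\<exists>C. \<forall>k x u i. u \<in> admissible_controls U \<and> norm x \<le> R \<and> norm (trajectory A B k x u) \<le> R \<and> i \<le> k
    \<longrightarrow> cmod (pairing w (trajectory A B i x u)) \<le> C"
proof (induction w rule: annihilated_by_eigenvalue_factors[where M = "transpose (map_matrix complex_of_real A)"])
  case 1
  show ?case
    by (auto simp: pairing_def)
next
  case (2 w \<nu> v)
  let ?w = "transpose (map_matrix complex_of_real A) *v w - \<nu> *s w"
  have \<nu>: "cmod \<nu> \<noteq> 1"
    using 2 assms(1) transpose_eigenvalue by (auto simp: hyperbolic_def)
  obtain C where C: "\<And>k x u i. \<lbrakk>u \<in> admissible_controls U; norm x \<le> R;
      norm (trajectory A B k x u) \<le> R; i \<le> k\<rbrakk> \<Longrightarrow> cmod (pairing ?w (trajectory A B i x u)) \<le> C"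
    using 2(1) by blast
  obtain L where L: "0 \<le> L" "\<And>x. cmod (pairing w x) \<le> L * norm x"
    using pairing_bound by blast
  have "bounded ((*v) B ` U)"
    by (rule bounded_linear_image[OF assms(2)]) (rule matrix_vector_mul_bounded_linear)
  then obtain N where N: "\<And>a. a \<in> U \<Longrightarrow> norm (B *v a) \<le> N"
    by (auto simp: bounded_iff)
  \<comment> \<open>The forcing has two sources: the already bounded pairing with \<open>?w\<close>,
    and the control input.\<close>
  define F where "F = \<bar>C\<bar> + L * \<bar>N\<bar>"
  have "cmod (pairing w (trajectory A B i x u)) \<le> L * R + F / \<bar>cmod \<nu> - 1\<bar>"
    if H: "u \<in> admissible_controls U" "norm x \<le> R" "norm (trajectory A B k x u) \<le> R" "i \<le> k"
    for k x u i
  proof (rule hyperbolic_recurrence_bound[where k = k])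
    fix i assume i: "i < k"
    let ?x = "trajectory A B i x u"
    have "pairing w (trajectory A B (Suc i) x u) - \<nu> * pairing w ?x =
        pairing ?w ?x + pairing w (B *v u i)"
      by (simp add: trajectory_Suc pairing_add_right pairing_eigen_diff pairing_matrix_mult)
    also have "cmod \<dots> \<le> C + L * norm (B *v u i)"
      using C[OF H(1-3), of i] i L by (intro order_trans[OF norm_triangle_ineq] add_mono) auto
    also have "\<dots> \<le> F"
      unfolding F_def using N[of "u i"] H(1) L(1)
      by (intro add_mono mult_left_mono) (auto simp: admissible_controls_def)
    finally show "cmod (pairing w (trajectory A B (Suc i) x u) - \<nu> * pairing w ?x) \<le> F" .
  next
    show "cmod (pairing w (trajectory A B 0 x u)) \<le> L * R" "cmod (pairing w (trajectory A B k x u)) \<le> L * R"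
      using H L by (auto intro: order_trans[OF L(2)] mult_left_mono)
    show "0 \<le> F"
      using L by (simp add: F_def)
  qed (use \<nu> H in auto)
  then show ?case
    by blast
qed

lemma hyperbolic_trajectory_bound:
  fixes A :: "real^'d^'d" and B :: "real^'m^'d"
  assumes "hyperbolic A" "bounded U"
  obtains C where "\<And>k x u i. \<lbrakk>u \<in> admissible_controls U; norm x \<le> R;
    norm (trajectory A B k x u) \<le> R; i \<le> k\<rbrakk> \<Longrightarrow> norm (trajectory A B i x u) \<le> C"
proof -
  \<comment> \<open>Pairing with standard basis vectors recovers the coordinates, whose bounds are
    summed at the end.\<close>
  have axis: "pairing (axis j 1) x = of_real (x $ j)" for j :: 'd and x
    by (simp add: pairing_def axis_def if_distrib[of "\<lambda>c. c * _"] cong: if_cong)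
  have "\<forall>j. \<exists>C. \<forall>k x u i. u \<in> admissible_controls U \<and> norm x \<le> R \<and> norm (trajectory A B k x u) \<le> R \<and> i \<le> k
    \<longrightarrow> \<bar>trajectory A B i x u $ j\<bar> \<le> C"
    using hyperbolic_pairing_bound[OF assms, of R B "axis _ 1"] unfolding axis norm_of_real by blast
  then obtain C where C: "\<And>j k x u i. \<lbrakk>u \<in> admissible_controls U; norm x \<le> R;
      norm (trajectory A B k x u) \<le> R; i \<le> k\<rbrakk> \<Longrightarrow> \<bar>trajectory A B i x u $ j\<bar> \<le> C j"
    unfolding choice_iff by blast
  have "norm (trajectory A B i x u) \<le> (\<Sum>j\<in>UNIV. C j)"
    if "u \<in> admissible_controls U" "norm x \<le> R" "norm (trajectory A B k x u) \<le> R" "i \<le> k" for k x u i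
    using C[OF that] by (intro order_trans[OF norm_le_l1_cart] sum_mono)
  then show ?thesis
    using that by blast
qed

text \<open>A trajectory from \<open>y\<close> to a point near \<open>x\<close> and back close to
  \<open>y\<close> has both ends in a fixed ball. The way back is chosen first, starting at
  \<open>x\<close>; by continuity it also works from the nearby state that is then reached from
  \<open>y\<close>.\<close>

lemma hyperbolic_imp_bounded_control_set:
  fixes A :: "real^'d^'d" and B :: "real^'m^'d"
  assumes "hyperbolic A" "bounded U" and D: "pre_control_set A B U D"
  shows "bounded D"
proof (cases "D = {}")
  case False
  then obtain y where y: "y \<in> D"
    by blast
  \<comment> \<open>The radius leaves room for an end state at distance less than \<open>1\<close>
    from \<open>y\<close>, and \<open>C\<close> does not depend on \<open>x\<close>.\<close>
  obtain C where C: "\<And>k x u i. \<lbrakk>u \<in> admissible_controls U; norm x \<le> norm y + 1;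
    norm (trajectory A B k x u) \<le> norm y + 1; i \<le> k\<rbrakk> \<Longrightarrow> norm (trajectory A B i x u) \<le> C"
    using hyperbolic_trajectory_bound[OF assms(1,2)] by metis
  have "norm x \<le> C + 1" if x: "x \<in> D" for x
  proof -
    have near: "norm z \<le> norm w + 1" if "dist z w < 1" for z w :: "real^'d"
      using norm_triangle_sub[of z w] that by (simp add: dist_norm)
    have "y \<in> closure (reachable_set A B U x)"
      using D x y by (auto simp: pre_control_set_def)
    then obtain l v where v: "v \<in> admissible_controls U" "dist (trajectory A B l x v) y < 1"
      unfolding closure_approachable reachable_set_def using zero_less_one by blast
    let ?f = "\<lambda>z. trajectory A B l z v"
    have "open (?f -` ball y 1)"
      using continuous_on_trajectory[of UNIV A B l v] by (auto intro: open_vimage)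
    moreover have "x \<in> ?f -` ball y 1"
      using v by (simp add: dist_commute)
    ultimately obtain \<delta> where \<delta>: "0 < \<delta>" "ball x \<delta> \<subseteq> ?f -` ball y 1"
      by (meson openE)
    have "x \<in> closure (reachable_set A B U y)"
      using D x y by (auto simp: pre_control_set_def)
    moreover have "0 < min \<delta> 1"
      using \<delta>(1) by simp
    ultimately obtain k u where u: "u \<in> admissible_controls U" "dist (trajectory A B k y u) x < min \<delta> 1"
      unfolding closure_approachable reachable_set_def by blast
    let ?x = "trajectory A B k y u" and ?u = "concat_controls k u v"
    have "?x \<in> ball x \<delta>"
      using u by (simp add: dist_commute)
    then have "dist (trajectory A B (k + l) y ?u) y < 1"
      using \<delta>(2) by (auto simp: trajectory_concat dist_commute)
    then have "norm (trajectory A B k y ?u) \<le> C"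
      using u v by (intro C[where k = "k + l"]) (auto simp: near concat_controls_admissible)
    then have "norm ?x \<le> C"
      by (simp add: trajectory_concat_left)
    then show ?thesis
      using near[of x ?x] u by (simp add: dist_commute)
  qed
  then show ?thesis
    by (auto simp: bounded_iff)
qed simp

theorem theorem19:
  fixes A :: "real^'d^'d" and B :: "real^'m^'d"
    and U :: "(real^'m) set" and D :: "(real^'d) set"
  assumes "invertible A"
    and "convex U" and "compact U" and "0 \<in> interior U" and "U = closure (interior U)"
    and "controllable A B"
    and "control_set A B U D" and "interior D \<noteq> {}"
  shows "bounded D \<longleftrightarrow> hyperbolic A"
proof
  show "hyperbolic A" if "bounded D"
    using bounded_control_set_imp_hyperbolic assms that by blast
  show "bounded D" if "hyperbolic A"
    using hyperbolic_imp_bounded_control_set[OF that compact_imp_bounded[OF assms(3)], of B D] assms(7)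
    by (simp add: control_set_def)
qed

end
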